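(* For all pairwise relatively prime positive integers $a,b,d$, $$g\left(\langle a,b\rangle/d\right)=\frac{1}{2d}(a-1)(b-1)+C_{a,b,d},$$ where $C_{a,b,d}$ is a constant depending only on $d$ and on the residue classes of $a$ and $b$ modulo $d$. That is, for any positive integer $d$ and any pairs $(a,b)$, $(a',b')$ of positive integers such that $a,b,d$ are pairwise relatively prime, $a',b',d$ are pairwise relatively prime, $a\equiv a'\pmod d$ and $b\equiv b'\pmod d$, one has $$g\left(\langle a,b\rangle/d\right)-\frac{1}{2d}(a-1)(b-1)=g\left(\langle a',b'\rangle/d\right)-\frac{1}{2d}(a'-1)(b'-1).$$
   Context: $\mathbb{N}$ denotes the set of nonnegative integers. A numerical semigroup is a subset of $\mathbb{N}$ that is closed under addition, contains $0$, and has finite complement in $\mathbb{N}$. For relatively prime positive integers $a,b$, $\langle a,b\rangle=\{c_1a+c_2b: c_1,c_2\in\mathbb{N}\}$, which is a numerical semigroup. For a numerical semigroup $S$ and a positive integer $d$, $S/d=\{x\in\mathbb{N}: dx\in S\}$, which is again a numerical semigroup. The genus of a numerical semigroup $S$ is $g(S)=|\mathbb{N}\setminus S|$. *)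

theory Defs
  imports Complex_Main "HOL-Number_Theory.Cong"
begin

definition numerical_semigroup :: "nat set \<Rightarrow> bool" where
  "numerical_semigroup S \<longleftrightarrow>
     0 \<in> S \<and> (\<forall>x\<in>S. \<forall>y\<in>S. x + y \<in> S) \<and> finite (UNIV - S)"

definition gen2 :: "nat \<Rightarrow> nat \<Rightarrow> nat set" where
  "gen2 a b = {c1 * a + c2 * b | c1 c2. True}"

definition quotient_semigroup :: "nat set \<Rightarrow> nat \<Rightarrow> nat set" where
  "quotient_semigroup S d = {x. d * x \<in> S}"

definition genus :: "nat set \<Rightarrow> nat" where
  "genus S = card (UNIV - S)"

text \<open>
  By the next two lemmas the complements whose cardinality \<open>genus\<close> takes in the theorem
  are finite, so the convention that \<open>card\<close> is 0 on infinite sets plays no role.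
\<close>

lemma numerical_semigroup_gen2:
  assumes "a > 0" "b > 0" "coprime a b"
  shows "numerical_semigroup (gen2 a b)"
proof -
  have mem: "n \<in> gen2 a b" if n: "a * b \<le> n" for n
  proof -
    obtain y where y: "[b * y = 1] (mod a)"
      using cong_solve_coprime_nat[of b a] assms(3) by (auto simp: coprime_commute)
    define x where "x = (y * n) mod a"
    have "[b * x = b * (y * n)] (mod a)"
      unfolding x_def by (intro cong_mult) (auto simp: cong_def)
    also have "[b * (y * n) = 1 * n] (mod a)"
      using cong_mult[OF y cong_refl[of n]] by (simp add: mult.assoc)
    finally have c: "[b * x = n] (mod a)" by simp
    have "x \<le> a" using assms unfolding x_def by (simp add: less_imp_le)
    then have "b * x \<le> n"
      using n by (metis mult.commute mult_le_mono2 order_trans)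
    moreover from this c have "a dvd n - b * x"
      by (metis cong_altdef_nat cong_sym)
    then obtain k where "n - b * x = a * k" by blast
    ultimately have "n = k * a + x * b" by (simp add: mult.commute)
    then show ?thesis unfolding gen2_def by blast
  qed
  then have "UNIV - gen2 a b \<subseteq> {..<a * b}" by (auto simp: not_less[symmetric])
  then have "finite (UNIV - gen2 a b)" by (rule finite_subset) simp
  moreover have "0 \<in> gen2 a b" unfolding gen2_def by force
  moreover have "x + y \<in> gen2 a b" if xy: "x \<in> gen2 a b" "y \<in> gen2 a b" for x y
  proof -
    obtain p q r s where "x = p * a + q * b" "y = r * a + s * b"
      using xy unfolding gen2_def by blast
    then have "x + y = (p + r) * a + (q + s) * b" by (simp add: algebra_simps)
    then show ?thesis unfolding gen2_def by blast
  qed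
  ultimately show ?thesis unfolding numerical_semigroup_def by blast
qed

lemma numerical_semigroup_quotient:
  assumes "numerical_semigroup S" "d > 0"
  shows "numerical_semigroup (quotient_semigroup S d)"
proof -
  have "(\<lambda>x. d * x) ` (UNIV - quotient_semigroup S d) \<subseteq> UNIV - S"
    by (auto simp: quotient_semigroup_def)
  then have "finite ((\<lambda>x. d * x) ` (UNIV - quotient_semigroup S d))"
    using assms(1) unfolding numerical_semigroup_def by (blast intro: finite_subset)
  then have "finite (UNIV - quotient_semigroup S d)"
    by (rule finite_imageD) (use assms(2) in \<open>auto simp: inj_on_def\<close>)
  then show ?thesis
    using assms(1)
    by (simp add: numerical_semigroup_def quotient_semigroup_def distrib_left)
qed

definition pairwise_coprime_pos :: "nat \<Rightarrow> nat \<Rightarrow> nat \<Rightarrow> bool" where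
  "pairwise_coprime_pos a b d \<longleftrightarrow>
     a > 0 \<and> b > 0 \<and> d > 0 \<and> coprime a b \<and> coprime a d \<and> coprime b d"

end

theory Submission
  imports Defs
begin

text \<open>
  Write \<open>T = \<langle>a,b\<rangle>/d\<close>. The genus of \<open>T\<close> is read off from its Apery set with respect to \<open>b\<close>, that is,
  from the least elements of \<open>T\<close> in the residue classes modulo \<open>b\<close>: the gaps in the class with
  least element \<open>w\<close> are \<open>w - b, w - 2b, \<dots>\<close>, so there are \<open>w div b\<close> of them
  (\<open>card_gaps_eq_sum_div\<close>). Summing over the classes gives Selmer's formula
  \<open>b g(T) = \<Sum> w - b (b - 1) / 2\<close>.

  The point is that this Apery set is explicit. As \<open>a\<close> is invertible modulo \<open>b\<close>, every residue
  class modulo \<open>b\<close> contains \<open>i a\<close> for exactly one \<open>i < b\<close>, and the least element of \<open>\<langle>a,b\<rangle>\<close> that is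
  divisible by \<open>d\<close> and lies in this class is \<open>i a + J i * b\<close>, where \<open>J i\<close> is the least \<open>j\<close> with \<open>d\<close>
  dividing \<open>i a + j b\<close>. Dividing these elements by \<open>d\<close> gives the Apery set of \<open>T\<close>
  (\<open>mem_quotient_iff_apery_le\<close>), hence
  \<open>g(T) = a (b - 1) / (2d) + (\<Sum>i<b. J i) / d - (b - 1) / 2\<close>.

  Now \<open>J i\<close> depends only on \<open>i\<close>, \<open>a\<close> and \<open>b\<close> modulo \<open>d\<close>, and as \<open>i\<close> runs through a period, \<open>J i\<close>
  takes each of the values \<open>0, \<dots>, d - 1\<close> once, so its average is \<open>(d - 1) / 2\<close>. Subtracting this average
  from every term leaves a sum over \<open>i < b\<close> that does not change when \<open>b\<close> is replaced by \<open>b mod d\<close>;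
  it therefore depends only on residues. The averages that were split off combine with
  \<open>a (b - 1) / (2d) - (b - 1) / 2\<close> to \<open>(a - 1) (b - 1) / (2d) + (d - 1) / (2d)\<close>.
\<close>

section \<open>Counting gaps by residue classes\<close>

lemma card_smaller_in_residue_class:
  fixes w m :: nat
  assumes "m > 0"
  shows "card {x. x mod m = w mod m \<and> x < w} = w div m"
proof -
  have "{x. x mod m = w mod m \<and> x < w} = (\<lambda>k. w mod m + k * m) ` {..<w div m}" (is "?L = ?R")
  proof
    show "?L \<subseteq> ?R"
    proof
      fix x assume x: "x \<in> ?L"
      have "x div m < w div m"
      proof (rule ccontr)
        assume "\<not> x div m < w div m"
        then have "w div m * m + w mod m \<le> x div m * m + x mod m"
          using x by (intro add_mono mult_right_mono) simp_all
        then show False using x by (simp only: div_mult_mod_eq) simp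
      qed
      moreover have "x = w mod m + (x div m) * m"
        using x mod_div_mult_eq[of x m] by simp
      ultimately show "x \<in> ?R" by blast
    qed
    show "?R \<subseteq> ?L"
    proof
      fix x assume "x \<in> ?R"
      then obtain k where k: "k < w div m" "x = w mod m + k * m" by auto
      then have "k * m < w div m * m" using assms by simp
      then have "x < w mod m + w div m * m" using k by linarith
      then show "x \<in> ?L" using k by simp
    qed
  qed
  moreover have "inj_on (\<lambda>k. w mod m + k * m) {..<w div m}"
    using assms by (auto simp: inj_on_def)
  ultimately show ?thesis by (simp add: card_image)
qed

text \<open>
  The index \<open>i\<close> is allowed to be any labelling of the residue classes, because the Apery set
  of \<open>\<langle>a,b\<rangle>/d\<close> is naturally labelled by the coefficient of \<open>a\<close> and not by the residue itself.
\<close>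

lemma card_gaps_eq_sum_div:
  fixes T :: "nat set" and w :: "nat \<Rightarrow> nat"
  assumes "m > 0"
    and bij: "bij_betw (\<lambda>i. w i mod m) {..<m} {..<m}"
    and mem: "\<And>i x. i < m \<Longrightarrow> x mod m = w i mod m \<Longrightarrow> x \<in> T \<longleftrightarrow> w i \<le> x"
  shows "card (UNIV - T) = (\<Sum>i<m. w i div m)"
proof -
  define G where "G i = {x. x mod m = w i mod m \<and> x < w i}" for i
  have "UNIV - T = (\<Union>i<m. G i)"
  proof
    show "UNIV - T \<subseteq> (\<Union>i<m. G i)"
    proof
      fix x assume x: "x \<in> UNIV - T"
      have "x mod m \<in> (\<lambda>i. w i mod m) ` {..<m}"
        using bij assms(1) by (simp add: bij_betw_def)
      then obtain i where i: "i < m" "x mod m = w i mod m" by auto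
      then show "x \<in> (\<Union>i<m. G i)" using x mem[OF i] by (auto simp: G_def)
    qed
    show "(\<Union>i<m. G i) \<subseteq> UNIV - T"
      using mem by (auto simp: G_def)
  qed
  moreover have "card (\<Union>i<m. G i) = (\<Sum>i<m. card (G i))"
  proof (rule card_UN_disjoint)
    show "\<forall>i\<in>{..<m}. finite (G i)"
      by (simp add: G_def)
    show "\<forall>i\<in>{..<m}. \<forall>j\<in>{..<m}. i \<noteq> j \<longrightarrow> G i \<inter> G j = {}"
    proof (intro ballI impI)
      fix i j assume ij: "i \<in> {..<m}" "j \<in> {..<m}" "i \<noteq> j"
      have "w i mod m \<noteq> w j mod m"
        using inj_on_contraD[OF bij_betw_imp_inj_on[OF bij] ij(3,1,2)] .
      then show "G i \<inter> G j = {}" by (auto simp: G_def)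
    qed
  qed simp
  ultimately show ?thesis
    using card_smaller_in_residue_class[OF assms(1)] by (simp add: G_def)
qed

lemma real_sum_lessThan_id: "(\<Sum>i<n. real i) = real n * (real n - 1) / 2"
  by (induction n) (auto simp: field_simps)

lemma selmer_formula:
  fixes w :: "nat \<Rightarrow> nat"
  assumes "bij_betw (\<lambda>i. w i mod m) {..<m} {..<m}"
  shows "real m * real (\<Sum>i<m. w i div m) = (\<Sum>i<m. real (w i)) - real m * (real m - 1) / 2"
proof -
  have "(\<Sum>i<m. real (w i mod m)) = (\<Sum>r<m. real r)"
    by (rule sum.reindex_bij_betw[OF assms])
  then have "(\<Sum>i<m. real (w i mod m)) = real m * (real m - 1) / 2"
    by (simp add: real_sum_lessThan_id)
  moreover have "(\<Sum>i<m. real (w i)) = (\<Sum>i<m. real m * real (w i div m) + real (w i mod m))"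
    by (intro sum.cong refl) (simp flip: of_nat_mult of_nat_add)
  ultimately show ?thesis
    by (simp add: sum.distrib sum_distrib_left)
qed

section \<open>The correction making \<open>i a + j b\<close> divisible by \<open>d\<close>\<close>

definition dvd_correction :: "nat \<Rightarrow> nat \<Rightarrow> nat \<Rightarrow> nat \<Rightarrow> nat" where
  "dvd_correction d a b i = (LEAST j. d dvd i * a + j * b)"

lemma dvd_correction_mod:
  "dvd_correction d (a mod d) (b mod d) (i mod d) = dvd_correction d a b i"
proof -
  have "((i mod d) * (a mod d) + j * (b mod d)) mod d = (i * a + j * b) mod d" for j
    unfolding cong_def[symmetric]
    by (intro cong_add cong_mult cong_refl) (simp_all add: cong_def)
  then show ?thesis by (simp add: dvd_correction_def dvd_eq_mod_eq_0)
qed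

lemma dvd_correction_le: "d dvd i * a + j * b \<Longrightarrow> dvd_correction d a b i \<le> j"
  unfolding dvd_correction_def by (rule Least_le)

lemma dvd_correction:
  assumes "d > 0" "coprime b d"
  shows dvd_correction_dvd: "d dvd i * a + dvd_correction d a b i * b"
    and dvd_correction_less: "dvd_correction d a b i < d"
proof -
  obtain y where y: "[b * y = 1] (mod d)"
    using cong_solve_coprime_nat[OF assms(2)] by auto
  \<comment> \<open>A solution \<open>j\<close> is \<open>- i a / b\<close> modulo \<open>d\<close>; the factor \<open>d - 1\<close> stands for \<open>-1\<close>.\<close>
  define j where "j = (d - 1) * (i * a) * y"
  have "[j * b = (d - 1) * (i * a) * 1] (mod d)"
    using cong_mult[OF cong_refl[of "(d - 1) * (i * a)"] y] by (simp add: j_def mult_ac)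
  then have "[i * a + j * b = i * a + (d - 1) * (i * a) * 1] (mod d)"
    by (rule cong_add[OF cong_refl])
  moreover have "i * a + (d - 1) * (i * a) * 1 = d * (i * a)"
    using assms(1) by (cases d) auto
  ultimately have j: "d dvd i * a + j * b"
    using cong_dvd_iff by fastforce
  then show "d dvd i * a + dvd_correction d a b i * b"
    unfolding dvd_correction_def by (rule LeastI)
  have "(i * a + (j mod d) * b) mod d = (i * a + j * b) mod d"
    unfolding cong_def[symmetric]
    by (intro cong_add cong_mult cong_refl) (simp_all add: cong_def)
  then have "d dvd i * a + (j mod d) * b"
    using j by (simp add: dvd_eq_mod_eq_0)
  then have "dvd_correction d a b i \<le> j mod d" by (rule dvd_correction_le)
  then show "dvd_correction d a b i < d"
    using assms(1) by (meson le_less_trans mod_less_divisor)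
qed

text \<open>
  The correction determines \<open>i a\<close> modulo \<open>d\<close>, hence \<open>i\<close> modulo \<open>d\<close>; so over one period
  it is an injection of \<open>{..<d}\<close> into itself.
\<close>

lemma bij_betw_dvd_correction:
  assumes "d > 0" "coprime a d" "coprime b d"
  shows "bij_betw (dvd_correction d a b) {..<d} {..<d}"
proof -
  have "inj_on (dvd_correction d a b) {..<d}"
  proof (rule inj_onI)
    fix i k assume ik: "i \<in> {..<d}" "k \<in> {..<d}" "dvd_correction d a b i = dvd_correction d a b k"
    have "d dvd i * a + dvd_correction d a b i * b" "d dvd k * a + dvd_correction d a b i * b"
      using dvd_correction_dvd[OF assms(1,3)] ik(3) by metis+
    then have "[i * a + dvd_correction d a b i * b = k * a + dvd_correction d a b i * b] (mod d)"
      by (simp add: cong_def dvd_eq_mod_eq_0)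
    then have "[i * a = k * a] (mod d)" by (simp only: cong_add_rcancel_nat)
    then have "[i = k] (mod d)" using assms(2) by (simp only: cong_mult_rcancel_nat)
    then show "i = k" using ik by (simp add: cong_def)
  qed
  moreover have "dvd_correction d a b ` {..<d} \<subseteq> {..<d}"
    using dvd_correction_less[OF assms(1,3)] by auto
  ultimately show ?thesis
    by (simp add: bij_betw_def endo_inj_surj)
qed

lemma sum_dvd_correction_centred:
  assumes "d > 0" "coprime a d" "coprime b d"
  shows "(\<Sum>i<d. real (dvd_correction d a b i) - (real d - 1) / 2) = 0"
proof -
  have "(\<Sum>i<d. real (dvd_correction d a b i)) = (\<Sum>j<d. real j)"
    by (rule sum.reindex_bij_betw[OF bij_betw_dvd_correction[OF assms]])
  then show ?thesis by (simp add: sum_subtractf real_sum_lessThan_id)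
qed

lemma sum_periodic_mod:
  fixes f :: "nat \<Rightarrow> real"
  assumes per: "\<And>i. f (i mod d) = f i" and zero: "(\<Sum>i<d. f i) = 0"
  shows "(\<Sum>i<n. f i) = (\<Sum>i<n mod d. f i)"
proof -
  have "(\<Sum>i<q * d + r. f i) = (\<Sum>i<r. f i)" for q r
  proof (induction q)
    case (Suc q)
    have shift: "f (d + i) = f i" for i
      using per[of "d + i"] per[of i] by simp
    have split: "(\<Sum>i<d + n. f i) = (\<Sum>i<d. f i) + (\<Sum>i<n. f (d + i))" for n
      by (induction n) simp_all
    have "(\<Sum>i<d + (q * d + r). f i) = (\<Sum>i<r. f i)"
      unfolding split zero shift Suc by simp
    then show ?case by (simp only: mult_Suc add.assoc)
  qed simp
  from this[of "n div d" "n mod d"] show ?thesis by simp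
qed

section \<open>The genus of the quotient\<close>

definition apery :: "nat \<Rightarrow> nat \<Rightarrow> nat \<Rightarrow> nat \<Rightarrow> nat" where
  "apery d a b i = (i * a + dvd_correction d a b i * b) div d"

lemma mult_apery:
  assumes "d > 0" "coprime b d"
  shows "d * apery d a b i = i * a + dvd_correction d a b i * b"
  using dvd_correction_dvd[OF assms] by (simp add: apery_def)

lemma bij_betw_apery_mod:
  assumes "d > 0" "b > 0" "coprime a b" "coprime b d"
  shows "bij_betw (\<lambda>i. apery d a b i mod b) {..<b} {..<b}"
proof -
  have "inj_on (\<lambda>i. apery d a b i mod b) {..<b}"
  proof (rule inj_onI)
    fix i k assume ik: "i \<in> {..<b}" "k \<in> {..<b}" "apery d a b i mod b = apery d a b k mod b"
    then have "[d * apery d a b i = d * apery d a b k] (mod b)"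
      by (intro cong_mult cong_refl) (simp add: cong_def)
    then have "[i * a = k * a] (mod b)"
      by (simp add: mult_apery[OF assms(1,4)] cong_def)
    then have "[i = k] (mod b)" using assms(3) by (simp only: cong_mult_rcancel_nat)
    then show "i = k" using ik by (simp add: cong_def)
  qed
  moreover have "(\<lambda>i. apery d a b i mod b) ` {..<b} \<subseteq> {..<b}"
    using assms(2) by auto
  ultimately show ?thesis by (simp add: bij_betw_def endo_inj_surj)
qed

text \<open>
  If \<open>d x = p a + q b\<close> with \<open>x\<close> in the class of \<open>apery d a b i\<close>, then \<open>p \<equiv> i\<close> modulo \<open>b\<close>. Trading
  \<open>b\<close> copies of \<open>a\<close> for \<open>a\<close> copies of \<open>b\<close> lowers \<open>p\<close> to \<open>i\<close>, after which the coefficient of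
  \<open>b\<close> is at least the minimal correction.
\<close>

lemma mem_quotient_iff_apery_le:
  assumes "d > 0" "coprime a b" "coprime b d" "i < b"
    and x: "x mod b = apery d a b i mod b"
  shows "x \<in> quotient_semigroup (gen2 a b) d \<longleftrightarrow> apery d a b i \<le> x"
proof
  let ?w = "apery d a b i" and ?J = "dvd_correction d a b i"
  note dw = mult_apery[OF assms(1,3), of a i]
  show "?w \<le> x" if "x \<in> quotient_semigroup (gen2 a b) d"
  proof -
    obtain p q where pq: "d * x = p * a + q * b"
      using \<open>x \<in> _\<close> by (auto simp: quotient_semigroup_def gen2_def)
    have "[d * x = d * ?w] (mod b)"
      using x by (intro cong_mult cong_refl) (simp add: cong_def)
    then have "[p * a = i * a] (mod b)"
      by (simp add: pq dw cong_def)
    then have "[p = i] (mod b)" using assms(2) by (simp only: cong_mult_rcancel_nat)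
    then have "p mod b = i" using assms(4) by (simp add: cong_def)
    then have "p = i + (p div b) * b" by (metis mod_div_mult_eq)
    then have "p * a = i * a + (p div b) * b * a" by (metis add_mult_distrib)
    then have dx: "d * x = i * a + (p div b * a + q) * b"
      using pq by (simp add: algebra_simps)
    then have "?J \<le> p div b * a + q"
      by (metis dvd_correction_le dvd_triv_left)
    then have "d * ?w \<le> d * x"
      unfolding dx dw by (intro add_left_mono mult_right_mono) simp_all
    then show ?thesis using assms(1) by simp
  qed
  show "x \<in> quotient_semigroup (gen2 a b) d" if "?w \<le> x"
  proof -
    have "b dvd x - ?w"
      using x that by (metis mod_eq_dvd_iff_nat)
    then obtain k where "x - ?w = b * k" by blast
    then have "x = ?w + b * k" using that by simp
    then have "d * x = i * a + (?J + d * k) * b"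
      using dw by (simp add: algebra_simps)
    then show ?thesis by (auto simp: quotient_semigroup_def gen2_def)
  qed
qed

lemma genus_quotient_gen2:
  assumes "d > 0" "b > 0" "coprime a b" "coprime b d"
  shows "real (genus (quotient_semigroup (gen2 a b) d)) =
    real a * (real b - 1) / (2 * real d) + (\<Sum>i<b. real (dvd_correction d a b i)) / real d
      - (real b - 1) / 2"
proof -
  define g where "g = real (genus (quotient_semigroup (gen2 a b) d))"
  define \<Sigma> where "\<Sigma> = (\<Sum>i<b. real (dvd_correction d a b i))"
  note bij = bij_betw_apery_mod[OF assms]
  have "genus (quotient_semigroup (gen2 a b) d) = (\<Sum>i<b. apery d a b i div b)"
    unfolding genus_def
    by (intro card_gaps_eq_sum_div assms(2) bij mem_quotient_iff_apery_le assms(1,3,4))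
  then have g: "real b * g = (\<Sum>i<b. real (apery d a b i)) - real b * (real b - 1) / 2"
    using selmer_formula[OF bij] by (simp add: g_def)
  have "real d * (\<Sum>i<b. real (apery d a b i)) = (\<Sum>i<b. real (d * apery d a b i))"
    by (simp add: sum_distrib_left)
  also have "\<dots> = (\<Sum>i<b. real i * real a + real (dvd_correction d a b i) * real b)"
    by (simp add: mult_apery[OF assms(1,4)])
  also have "\<dots> = (\<Sum>i<b. real i) * real a + \<Sigma> * real b"
    by (simp add: \<Sigma>_def sum.distrib sum_distrib_right)
  finally have w: "real d * (\<Sum>i<b. real (apery d a b i))
      = real b * (real a * (real b - 1) / 2 + \<Sigma>)"
    by (simp add: real_sum_lessThan_id field_simps)
  have "real b * (real d * g)
      = real d * (\<Sum>i<b. real (apery d a b i)) - real b * (real d * (real b - 1) / 2)"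
    using arg_cong[OF g, of "\<lambda>t. real d * t"] by (simp add: algebra_simps)
  also have "\<dots> = real b * (real a * (real b - 1) / 2 + \<Sigma> - real d * (real b - 1) / 2)"
    by (simp add: w algebra_simps)
  finally have "real d * g = real a * (real b - 1) / 2 + \<Sigma> - real d * (real b - 1) / 2"
    using assms(2) by simp
  then have "g = (real a * (real b - 1) / 2 + \<Sigma> - real d * (real b - 1) / 2) / real d"
    using assms(1) by (simp add: field_simps)
  then show ?thesis
    using assms(1) by (simp add: g_def \<Sigma>_def add_divide_distrib diff_divide_distrib)
qed

text \<open>
  In the genus formula above, \<open>a (b - 1) / (2d) - (b - 1) / 2\<close> exceeds the main term
  \<open>(a - 1) (b - 1) / (2d)\<close> by \<open>- (b - 1) (d - 1) / (2d)\<close>. The averages taken off the \<open>b\<close>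
  corrections add up to \<open>b (d - 1) / (2d)\<close>, which leaves the last summand.
\<close>

definition genus_constant :: "nat \<Rightarrow> nat \<Rightarrow> nat \<Rightarrow> real" where
  "genus_constant d a b =
    (\<Sum>i<b. real (dvd_correction d a b i) - (real d - 1) / 2) / real d + (real d - 1) / (2 * real d)"

lemma genus_constant_mod:
  assumes "d > 0" "coprime a d" "coprime b d"
  shows "genus_constant d (a mod d) (b mod d) = genus_constant d a b"
proof -
  define f where "f i = real (dvd_correction d a b i) - (real d - 1) / 2" for i
  have corr_mod: "dvd_correction d (a mod d) (b mod d) i = dvd_correction d a b i" for i
    using dvd_correction_mod[of d "a mod d" "b mod d" i] dvd_correction_mod[of d a b i] by simp
  have "f (i mod d) = f i" for i
    using dvd_correction_mod[of d a b "i mod d"] dvd_correction_mod[of d a b i] by (simp add: f_def)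
  then have "(\<Sum>i<b. f i) = (\<Sum>i<b mod d. f i)"
    by (rule sum_periodic_mod) (use sum_dvd_correction_centred[OF assms] in \<open>simp add: f_def\<close>)
  then show ?thesis by (simp add: genus_constant_def corr_mod f_def)
qed

lemma genus_quotient_eq_constant:
  assumes "pairwise_coprime_pos a b d"
  shows "real (genus (quotient_semigroup (gen2 a b) d)) =
    1 / (2 * real d) * (real a - 1) * (real b - 1) + genus_constant d (a mod d) (b mod d)"
proof -
  have *: "d > 0" "b > 0" "coprime a b" "coprime a d" "coprime b d"
    using assms by (auto simp: pairwise_coprime_pos_def)
  have "genus_constant d a b =
      ((\<Sum>i<b. real (dvd_correction d a b i)) - real b * ((real d - 1) / 2)) / real d
        + (real d - 1) / (2 * real d)"
    by (simp add: genus_constant_def sum_subtractf)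
  then show ?thesis
    unfolding genus_quotient_gen2[OF *(1,2,3,5)] genus_constant_mod[OF *(1,4,5)]
    using *(1) by (simp add: field_simps)
qed

theorem theorem2p2:
  shows "(\<exists>C :: nat \<Rightarrow> nat \<Rightarrow> nat \<Rightarrow> real. \<forall>a b d :: nat.
            pairwise_coprime_pos a b d \<longrightarrow>
            real (genus (quotient_semigroup (gen2 a b) d)) =
              1 / (2 * real d) * (real a - 1) * (real b - 1) + C d (a mod d) (b mod d)) \<and>
         (\<forall>d a b a' b' :: nat.
            pairwise_coprime_pos a b d \<longrightarrow> pairwise_coprime_pos a' b' d \<longrightarrow>
            [a = a'] (mod d) \<longrightarrow> [b = b'] (mod d) \<longrightarrow>
            real (genus (quotient_semigroup (gen2 a b) d))
                - 1 / (2 * real d) * (real a - 1) * (real b - 1) =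
            real (genus (quotient_semigroup (gen2 a' b') d))
                - 1 / (2 * real d) * (real a' - 1) * (real b' - 1))"
proof (intro conjI exI[of _ genus_constant] allI impI)
  show "real (genus (quotient_semigroup (gen2 a b) d)) =
      1 / (2 * real d) * (real a - 1) * (real b - 1) + genus_constant d (a mod d) (b mod d)"
    if "pairwise_coprime_pos a b d" for a b d
    using that by (rule genus_quotient_eq_constant)
  show "real (genus (quotient_semigroup (gen2 a b) d))
        - 1 / (2 * real d) * (real a - 1) * (real b - 1) =
      real (genus (quotient_semigroup (gen2 a' b') d))
        - 1 / (2 * real d) * (real a' - 1) * (real b' - 1)"
    if "pairwise_coprime_pos a b d" "pairwise_coprime_pos a' b' d"
      "[a = a'] (mod d)" "[b = b'] (mod d)" for d a b a' b'
    using that(3,4) unfolding genus_quotient_eq_constant[OF that(1)]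
      genus_quotient_eq_constant[OF that(2)] by (simp only: cong_def)
qed

end
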